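(* Let $m,n\ge1$. The number of hyposylvester classes of $m$-parking functions of length $n$ is equal to the number of $(2m+1)$-ary trees with $n$ (internal) nodes.
   Context: An $m$-parking function of length $n$ is a word of length $n$ over the positive integers whose nondecreasing rearrangement $a_1\le a_2\le\cdots\le a_n$ satisfies $a_i\le m(i-1)+1$ for all $i$. The hyposylvester congruence is the equivalence relation on words over the positive integers generated by: (1) $w=x\,ac\,y\equiv x\,ca\,y$ for letters $a<c$ and words $x,y$, whenever some letter $b$ with $a<b<c$ occurs (anywhere) in $w$; (2) $x\,ab\,y\,a\,z\equiv x\,ba\,y\,a\,z$ for letters $a<b$ and words $x,y,z$. *)

theory Defs
  imports Main
begin

definition words :: "nat list set" where
  "words = lists {0<..}"

text \<open>Lists are indexed from 0, so the condition \<open>a_i \<le> m (i - 1) + 1\<close> for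
  \<open>1 \<le> i \<le> n\<close> becomes \<open>sort w ! i \<le> m * i + 1\<close> for \<open>i < n\<close>.\<close>

definition parking_functions :: "nat \<Rightarrow> nat \<Rightarrow> nat list set" where
  "parking_functions m n =
     {w \<in> words. length w = n \<and> (\<forall>i<n. sort w ! i \<le> m * i + 1)}"

inductive hypo_step :: "nat list \<Rightarrow> nat list \<Rightarrow> bool" where
  between: "\<lbrakk>a < b; b < c; b \<in> set (x @ [a, c] @ y)\<rbrakk>
    \<Longrightarrow> hypo_step (x @ [a, c] @ y) (x @ [c, a] @ y)"
| repeated: "a < b
    \<Longrightarrow> hypo_step (x @ [a, b] @ y @ [a] @ z) (x @ [b, a] @ y @ [a] @ z)"

text \<open>The elementary steps permute letters, so they never leave \<^const>\<open>words\<close>; the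
  restriction below therefore gives the equivalence relation on \<^const>\<open>words\<close> generated
  by the steps.\<close>

definition hyposylvester :: "(nat list \<times> nat list) set" where
  "hyposylvester = {(u, v). u \<in> words \<and> v \<in> words \<and> equivclp hypo_step u v}"

lemma equiv_hyposylvester: "equiv words hyposylvester"
  by (rule equivI)
     (auto simp: hyposylvester_def refl_on_def
           intro!: symI transI intro: equivclp_sym equivclp_trans)

text \<open>Plane trees in which the external nodes \<open>Leaf\<close> are kept apart from internal
  nodes; a \<open>k\<close>-ary tree is one whose internal nodes all have exactly \<open>k\<close> ordered
  subtrees, each possibly a \<open>Leaf\<close>.\<close>

datatype tree = Leaf | Node "tree list"

fun kary :: "nat \<Rightarrow> tree \<Rightarrow> bool" where
  "kary k Leaf \<longleftrightarrow> True"
| "kary k (Node ts) \<longleftrightarrow> length ts = k \<and> (\<forall>t \<in> set ts. kary k t)"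

fun internal_nodes :: "tree \<Rightarrow> nat" where
  "internal_nodes Leaf = 0"
| "internal_nodes (Node ts) = 1 + sum_list (map internal_nodes ts)"

definition kary_trees :: "nat \<Rightarrow> nat \<Rightarrow> tree set" where
  "kary_trees k n = {t. kary k t \<and> internal_nodes t = n}"

end

theory Submission
  imports Defs "HOL-Library.Multiset"
begin

text \<open>Call \<open>a\<close> the predecessor of a letter \<open>x\<close> of \<open>w\<close> if \<open>a\<close> is the next smaller letter
  occurring in \<open>w\<close>. Modulo the congruence only the following information on \<open>w\<close> matters: its
  content, and for each letter \<open>x\<close> how many of its copies have no copy of the predecessor of
  \<open>x\<close> to their right. Replacing these copies of \<open>x\<close> by \<open>2 * x - 1\<close> and the other ones by
  \<open>2 * x - 2\<close> records both; sorting the result gives a complete invariant, with canonical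
  representative ``even codes in decreasing order, then odd codes in increasing order''.
  Since halving recovers the content, the invariants of \<open>m\<close>-parking functions are exactly the
  nondecreasing \<open>2m\<close>-parking functions, and these record the numbers of external nodes visited
  before each internal node in a preorder traversal of a \<open>(2m+1)\<close>-ary tree.\<close>

section \<open>Predecessors, codes and canonical words\<close>

definition covers :: "nat set \<Rightarrow> nat \<Rightarrow> nat \<Rightarrow> bool" where
  "covers S a b \<longleftrightarrow> a \<in> S \<and> a < b \<and> (\<forall>c\<in>S. \<not> (a < c \<and> c < b))"

text \<open>The set \<open>S\<close> is a parameter because predecessors refer to the whole word,
  whereas the recursion shortens it.\<close>

fun codes :: "nat set \<Rightarrow> nat list \<Rightarrow> nat list" where
  "codes S [] = []"
| "codes S (x # s) = (if \<exists>a\<in>set s. covers S a x then 2 * x - 2 else 2 * x - 1) # codes S s"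

text \<open>A common left inverse of both code maps on positive letters; at 0 truncated subtraction
  breaks this, hence the assumption \<open>0 \<notin> set w\<close> below.\<close>

definition letter :: "nat \<Rightarrow> nat" where
  "letter c = c div 2 + 1"

definition decode :: "nat list \<Rightarrow> nat list" where
  "decode cs = rev (sort (map letter (filter even cs))) @ sort (map letter (filter odd cs))"

text \<open>The elementary steps, with the letters available for the first rule fixed to a set \<open>S\<close>
  instead of being read off the word: this makes the steps compatible with \<open>Cons\<close>.\<close>

inductive rel_step :: "nat set \<Rightarrow> nat list \<Rightarrow> nat list \<Rightarrow> bool" for S where
  swap: "\<lbrakk>a < b; \<not> covers S a b \<or> a \<in> set s\<rbrakk> \<Longrightarrow> rel_step S (a # b # s) (b # a # s)"
| cons: "rel_step S u v \<Longrightarrow> rel_step S (x # u) (x # v)"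

lemma covers_unique: "covers S a x \<Longrightarrow> covers S b x \<Longrightarrow> a = b"
  unfolding covers_def by (metis linorder_neqE_nat)

lemma covers_less: "covers S a x \<Longrightarrow> a < x"
  by (simp add: covers_def)

lemma ex_covers:
  assumes "finite S" "a \<in> S" "a < x"
  shows "\<exists>b\<in>S. covers S b x"
proof -
  let ?A = "{z\<in>S. z < x}"
  have "finite ?A" "?A \<noteq> {}" using assms by auto
  then have "Max ?A \<in> ?A" "\<forall>z\<in>?A. z \<le> Max ?A" using Max_in[of ?A] by simp_all
  then show ?thesis unfolding covers_def by (metis (mono_tags, lifting) linorder_not_less mem_Collect_eq)
qed

lemma letter_code:
  "0 < x \<Longrightarrow> letter (2 * x - Suc 0) = x" "0 < x \<Longrightarrow> letter (2 * x - 2) = x"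
  by (auto simp: letter_def elim!: lessE)

lemma length_codes [simp]: "length (codes S w) = length w"
  by (induction w) auto

lemma map_letter_codes: "0 \<notin> set w \<Longrightarrow> map letter (codes S w) = w"
proof (induction w)
  case (Cons x w)
  then have "0 < x" by auto
  with Cons show ?case by (auto simp: letter_code simp del: mult_Suc_right)
qed simp

text \<open>Code 0 could only come from a letter 1 with a smaller letter to its right.\<close>

lemma codes_positive: "0 \<notin> set w \<Longrightarrow> 0 \<notin> set (codes S w)"
proof (induction w)
  case (Cons x w)
  have "1 < x" if "a \<in> set w" "covers S a x" for a
    using Cons.prems that covers_less[OF that(2)] by (cases a) auto
  with Cons show ?case by (fastforce split: if_splits)
qed simp

section \<open>Invariance of the codes under elementary steps\<close>

lemma mset_codes_append:
  assumes "set u = set v" "mset (codes S u) = mset (codes S v)"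
  shows "mset (codes S (p @ u)) = mset (codes S (p @ v))"
  by (induction p) (use assms in auto)

lemma hypo_step_mset: "hypo_step u v \<Longrightarrow> mset u = mset v"
  by (induction rule: hypo_step.induct) auto

text \<open>A code in the prefix depends on what follows only through its set of letters, so only
  the exchanged pair matters. In the first rule neither letter is the predecessor of the other; in
  the second, the later copy of \<open>a\<close> still stands to the right of \<open>b\<close> in
  either order.\<close>

lemma hypo_step_codes:
  assumes "hypo_step u v"
  shows "mset (codes (set u) u) = mset (codes (set v) v)"
proof -
  have "set u = set v" using hypo_step_mset[OF assms] by (rule mset_eq_setD)
  moreover have "mset (codes (set u) u) = mset (codes (set u) v)"
    using assms
  proof cases
    case (between a b c x y)
    have "\<not> covers (set u) a c" "\<not> covers (set u) c a"
      using between by (auto simp: covers_def)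
    then show ?thesis unfolding between(1,2)
      by (intro mset_codes_append) (auto simp flip: between(1))
  next
    case (repeated a b x y z)
    have "\<not> covers S b a" for S using repeated by (auto simp: covers_def)
    then show ?thesis unfolding repeated(1,2)
      by (intro mset_codes_append) (auto simp flip: repeated(1))
  qed
  ultimately show ?thesis by simp
qed

lemma equivclp_hypo_step_invariants:
  "equivclp hypo_step u v \<Longrightarrow> mset u = mset v \<and> mset (codes (set u) u) = mset (codes (set v) v)"
  by (induction rule: equivclp_induct) (auto dest: hypo_step_mset hypo_step_codes)

section \<open>Reduction to the canonical word\<close>

lemma rel_step_mset: "rel_step S u v \<Longrightarrow> mset u = mset v"
  by (induction rule: rel_step.induct) auto

text \<open>The prefix \<open>p\<close> collects the letters stripped off by \<open>cons\<close>. If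
  \<open>a\<close> does not recur in \<open>s\<close>, it is not the predecessor of
  \<open>b\<close>, so a letter of \<open>S\<close> separates the two.\<close>

lemma rel_step_imp_hypo_step:
  "rel_step S u v \<Longrightarrow> set (p @ u) = S \<Longrightarrow> hypo_step (p @ u) (p @ v)"
proof (induction arbitrary: p rule: rel_step.induct)
  case (swap a b s)
  show ?case
  proof (cases "a \<in> set s")
    case True
    then obtain y z where "s = y @ a # z" by (auto simp: in_set_conv_decomp)
    then show ?thesis using repeated[OF swap(1), of p y z] by simp
  next
    case False
    with swap obtain c where "c \<in> S" "a < c" "c < b"
      by (auto simp: covers_def)
    then show ?thesis using between[of a c b p s] swap.prems by auto
  qed
next
  case (cons u v x)
  then show ?case using cons.IH[of "p @ [x]"] by simp
qed

lemma equivclp_rel_step_imp_hypo_step: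
  assumes "equivclp (rel_step S) u v" "set u = S"
  shows "equivclp hypo_step u v"
proof -
  have "equivclp hypo_step u v \<and> set v = S"
    using assms
  proof (induction rule: equivclp_induct)
    case (step y z)
    have "set z = S"
      using step rel_step_mset mset_eq_setD by metis
    moreover have "hypo_step y z \<or> hypo_step z y"
      using step rel_step_imp_hypo_step[of S _ _ "[]"] \<open>set z = S\<close> by auto
    ultimately show ?case
      using step by (meson equivclp_into_equivclp)
  qed simp
  then show ?thesis ..
qed

lemma equivclp_rel_step_Cons:
  "equivclp (rel_step S) u v \<Longrightarrow> equivclp (rel_step S) (x # u) (x # v)"
  by (induction rule: equivclp_induct) (auto intro: rel_step.cons equivclp_into_equivclp)

text \<open>A pair is blocked only if its smaller letter covers the larger and does not recur to the
  right; a copy in \<open>s\<close> stays to the right throughout the passage.\<close>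

lemma move_right:
  assumes "\<And>y. y \<in> set q \<Longrightarrow> y < x \<Longrightarrow> covers S y x \<Longrightarrow> y \<in> set s"
    and "\<And>y. y \<in> set q \<Longrightarrow> x < y \<Longrightarrow> covers S x y \<Longrightarrow> x \<in> set s"
  shows "equivclp (rel_step S) (x # q @ s) (q @ x # s)"
  using assms
proof (induction q)
  case (Cons y q)
  have "rel_step S (x # y # q @ s) (y # x # q @ s) \<or> x = y
      \<or> rel_step S (y # x # q @ s) (x # y # q @ s)"
    using Cons.prems[of y] by (cases x y rule: linorder_cases) (auto intro!: rel_step.swap)
  then have "equivclp (rel_step S) (x # y # q @ s) (y # x # q @ s)"
    by (auto intro: r_into_equivclp equivclp_sym)
  moreover have "equivclp (rel_step S) (y # x # q @ s) (y # q @ x # s)"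
    using Cons by (intro equivclp_rel_step_Cons) auto
  ultimately show ?case by (auto intro: equivclp_trans)
qed simp

text \<open>The two splittings differ in the place of ties. Since the even block is reversed, in
  both uses \<open>x\<close> stops in front of its equal copies, which then justify passing the
  larger letters it covers.\<close>

lemma sort_Cons_split_le:
  fixes x :: "'a :: linorder"
  obtains l r where "sort xs = l @ r" "sort (x # xs) = l @ x # r"
    "\<forall>y\<in>set l. y \<le> x" "\<forall>y\<in>set r. x < y"
proof
  let ?l = "sort (filter (\<lambda>y. y \<le> x) xs)" and ?r = "sort (filter (\<lambda>y. \<not> y \<le> x) xs)"
  show "sort xs = ?l @ ?r"
    by (rule properties_for_sort) (auto simp: sorted_append simp flip: multiset_partition)
  show "sort (x # xs) = ?l @ x # ?r"
    by (rule properties_for_sort) (auto simp: sorted_append simp flip: multiset_partition)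
qed auto

lemma sort_Cons_split_less:
  fixes x :: "'a :: linorder"
  obtains l r where "sort xs = l @ r" "sort (x # xs) = l @ x # r"
    "\<forall>y\<in>set l. y < x" "\<forall>y\<in>set r. x \<le> y"
proof
  let ?l = "sort (filter (\<lambda>y. y < x) xs)" and ?r = "sort (filter (\<lambda>y. \<not> y < x) xs)"
  show "sort xs = ?l @ ?r"
    by (rule properties_for_sort) (auto simp: sorted_append simp flip: multiset_partition)
  show "sort (x # xs) = ?l @ x # ?r"
    by (rule properties_for_sort) (auto simp: sorted_append simp flip: multiset_partition)
qed auto

lemma mset_decode: "mset (decode cs) = image_mset letter (mset cs)"
proof -
  have "mset cs = filter_mset even (mset cs) + filter_mset odd (mset cs)"
    by (rule multiset_partition)
  then show ?thesis
    unfolding decode_def by (metis image_mset_union mset_append mset_filter mset_map mset_rev mset_sort)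
qed

lemma decode_cong:
  assumes "mset cs = mset ds"
  shows "decode cs = decode ds"
proof -
  have "sort (map letter (filter P cs)) = sort (map letter (filter P ds))" for P
    using assms by (intro properties_for_sort) auto
  then show ?thesis by (simp add: decode_def)
qed

lemma covers_if_even_code:
  "\<lbrakk>0 \<notin> set w; c \<in> set (codes S w); even c\<rbrakk> \<Longrightarrow> \<exists>a\<in>set w. covers S a (letter c)"
proof (induction w)
  case (Cons x w)
  then have "0 < x" by auto
  with Cons show ?case
    by (auto simp: letter_code split: if_splits)
qed simp

text \<open>Insertion sort from the right: once the tail is in canonical form, the new first letter
  is moved to its place in the even or the odd block.\<close>

lemma equivclp_rel_step_decode:
  "\<lbrakk>set w \<subseteq> S; 0 \<notin> set w\<rbrakk> \<Longrightarrow> equivclp (rel_step S) w (decode (codes S w))"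
proof (induction w)
  case (Cons x w)
  define evs ods where "evs = map letter (filter even (codes S w))"
    and "ods = map letter (filter odd (codes S w))"
  have x: "0 < x" "x \<in> S" and w: "0 \<notin> set w" "set w \<subseteq> S" using Cons.prems by auto
  have dec: "decode (codes S w) = rev (sort evs) @ sort ods"
    by (simp add: decode_def evs_def ods_def)
  have "set (decode (codes S w)) = set w"
    using mset_decode[of "codes S w"] map_letter_codes[OF w(1)]
    by (metis mset_eq_setD mset_map)
  then have set_w: "set w = set evs \<union> set ods" by (auto simp: dec)
  have evs: "\<exists>a\<in>set w. covers S a y" if "y \<in> set evs" for y
    using that covers_if_even_code[OF w(1)] by (auto simp: evs_def)
  \<comment> \<open>An even code of \<open>y\<close> guarantees a predecessor in \<open>w\<close>;
    by uniqueness it is \<open>x\<close>.\<close>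
  have x_in_w: "x \<in> set w" if "y \<in> set evs" "covers S x y" for y
    using evs[OF that(1)] that(2) covers_unique by blast
  have "equivclp (rel_step S) (x # rev (sort evs) @ sort ods) (decode (codes S (x # w)))"
  proof (cases "\<exists>a\<in>set w. covers S a x")
    case True
    obtain l r where lr: "sort evs = l @ r" "sort (x # evs) = l @ x # r"
      "\<forall>y\<in>set l. y \<le> x" "\<forall>y\<in>set r. x < y" by (rule sort_Cons_split_le)
    have "set evs = set l \<union> set r" using lr(1) by (metis set_append set_sort)
    \<comment> \<open>Only larger letters are passed. If \<open>x\<close> covers one of them, a copy
      of \<open>x\<close> occurs in \<open>w\<close> and, not being in \<open>r\<close>, lies
      further right.\<close>
    have "equivclp (rel_step S) (x # rev r @ rev l @ sort ods) (rev r @ x # rev l @ sort ods)"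
      by (rule move_right) (use lr x_in_w set_w \<open>set evs = _\<close> in auto)
    moreover have "decode (codes S (x # w)) = rev (sort (x # evs)) @ sort ods"
      using True x by (simp add: decode_def evs_def ods_def letter_code)
    ultimately show ?thesis by (simp add: lr del: sort_key_simps codes.simps)
  next
    case False
    obtain l r where lr: "sort ods = l @ r" "sort (x # ods) = l @ x # r"
      "\<forall>y\<in>set l. y < x" "\<forall>y\<in>set r. x \<le> y" by (rule sort_Cons_split_less)
    have "set ods = set l \<union> set r" using lr(1) by (metis set_append set_sort)
    moreover have "x \<notin> set evs" using False evs by auto
    \<comment> \<open>Smaller letters are passed freely, as the predecessor of \<open>x\<close> is
      absent from \<open>w\<close>. Larger ones lie in \<open>evs\<close>; if \<open>x\<close>
      covers one, the copy of \<open>x\<close> in \<open>w\<close> is neither in \<open>evs\<close>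
      nor in \<open>l\<close>, hence in \<open>r\<close>.\<close>
    ultimately have "equivclp (rel_step S) (x # (rev (sort evs) @ l) @ r) ((rev (sort evs) @ l) @ x # r)"
      by (intro move_right) (use lr x_in_w set_w False in auto)
    moreover have "decode (codes S (x # w)) = rev (sort evs) @ sort (x # ods)"
      using False x by (simp add: decode_def evs_def ods_def letter_code)
    ultimately show ?thesis by (simp add: lr del: sort_key_simps codes.simps)
  qed
  moreover have "equivclp (rel_step S) (x # w) (x # rev (sort evs) @ sort ods)"
    using Cons dec by (auto intro!: equivclp_rel_step_Cons)
  ultimately show ?case by (blast intro: equivclp_trans)
qed (simp add: decode_def)

lemma equivclp_hypo_step_iff:
  assumes "u \<in> words" "v \<in> words"
  shows "equivclp hypo_step u v \<longleftrightarrow> sort (codes (set u) u) = sort (codes (set v) v)"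
proof
  assume "equivclp hypo_step u v"
  then show "sort (codes (set u) u) = sort (codes (set v) v)"
    using equivclp_hypo_step_invariants by (metis properties_for_sort mset_sort sorted_sort)
next
  assume "sort (codes (set u) u) = sort (codes (set v) v)"
  then have "decode (codes (set u) u) = decode (codes (set v) v)"
    by (intro decode_cong) (metis mset_sort)
  moreover have "equivclp hypo_step w (decode (codes (set w) w))" if "w \<in> words" for w
    using that by (intro equivclp_rel_step_imp_hypo_step[of "set w"] equivclp_rel_step_decode)
      (auto simp: words_def)
  ultimately show "equivclp hypo_step u v"
    using assms by (metis equivclp_sym equivclp_trans)
qed

section \<open>Sorted codes of parking functions: the nondecreasing \<open>2m\<close>-parking
  functions \<open>ballots (2 * m) 1 n\<close>\<close>

definition ballots :: "nat \<Rightarrow> nat \<Rightarrow> nat \<Rightarrow> nat list set" where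
  "ballots M p n = {b. sorted b \<and> length b = n \<and> (\<forall>i<n. 0 < b ! i \<and> b ! i \<le> p + M * i)}"

text \<open>Being monotone, \<open>letter\<close> commutes with sorting.\<close>

lemma sort_conv_map_letter_codes:
  assumes "0 \<notin> set w"
  shows "sort w = map letter (sort (codes S w))"
proof (rule properties_for_sort)
  show "mset (map letter (sort (codes S w))) = mset w"
    using map_letter_codes[OF assms] by (metis mset_map mset_sort)
  have "mono letter" by (auto simp: letter_def mono_def intro: div_le_mono)
  then show "sorted (map letter (sort (codes S w)))"
    by (simp add: sorted_map mono_def sorted_wrt_mono_rel[of _ "(\<le>)"])
qed

lemma parking_function_iff_ballot:
  assumes "w \<in> words"
  shows "w \<in> parking_functions m n \<longleftrightarrow> sort (codes (set w) w) \<in> ballots (2 * m) 1 n"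
proof -
  define cs where "cs = sort (codes (set w) w)"
  have "0 \<notin> set w" using assms by (auto simp: words_def)
  then have "sort w = map letter cs" "0 \<notin> set cs"
    using sort_conv_map_letter_codes codes_positive by (auto simp: cs_def)
  moreover have "length cs = length w" "sorted cs" by (simp_all add: cs_def)
  moreover have "letter c \<le> m * i + 1 \<longleftrightarrow> c \<le> 1 + 2 * m * i" for c i
    by (auto simp: letter_def)
  moreover have "0 < cs ! i" if "i < length cs" for i
    using that \<open>0 \<notin> set cs\<close> by (metis gr0I nth_mem)
  ultimately show ?thesis
    using assms by (auto simp: parking_functions_def ballots_def simp flip: cs_def)
qed

lemma codes_sorted: "sorted w \<Longrightarrow> codes S w = map (\<lambda>x. 2 * x - 1) w"
  by (induction w) (fastforce dest: covers_less)+

text \<open>A predecessor is smaller than its letter, so in front of the nonincreasing rest it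
  cannot be the current head and must occur later.\<close>

lemma codes_decreasing_append:
  "\<lbrakk>sorted_wrt (\<ge>) u; \<forall>x\<in>set u. \<exists>a\<in>set (u @ v). covers S a x\<rbrakk>
    \<Longrightarrow> codes S (u @ v) = map (\<lambda>x. 2 * x - 2) u @ codes S v"
proof (induction u)
  case (Cons x u)
  have later: "\<exists>a\<in>set (u @ v). covers S a y" if "y \<in> set (x # u)" for y
  proof -
    obtain a where a: "a \<in> set (x # u @ v)" "covers S a y"
      using Cons.prems(2) \<open>y \<in> set (x # u)\<close> by auto
    moreover have "a < x"
      using Cons.prems(1) that covers_less[OF a(2)] by auto
    ultimately show ?thesis by auto
  qed
  then show ?case using Cons by auto
qed simp

text \<open>Code 1 puts the letter 1 into the decoded word. A positive even code decodes to a letter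
  above 1, which therefore has a predecessor and recovers its even code; the increasing odd block
  has no smaller letter to the right.\<close>

lemma mset_codes_decode:
  assumes "0 \<notin> set cs" "cs \<noteq> [] \<Longrightarrow> 1 \<in> set cs"
  shows "mset (codes (set (decode cs)) (decode cs)) = mset cs"
proof -
  define S where "S = set (decode cs)"
  define evs ods where "evs = map letter (filter even cs)" and "ods = map letter (filter odd cs)"
  have dec: "decode cs = rev (sort evs) @ sort ods"
    by (simp add: decode_def evs_def ods_def)
  have "\<exists>a\<in>S. covers S a x" if x: "x \<in> set evs" for x
  proof (rule ex_covers)
    obtain c where c: "c \<in> set cs" "even c" "x = letter c" using x by (auto simp: evs_def)
    then have "cs \<noteq> []" by auto
    then show "letter 1 \<in> S"
      using assms(2) mset_decode[of cs] by (metis S_def image_eqI mset_eq_setD mset_map set_map)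
    have "c \<noteq> 0" using c(1) assms(1) by metis
    then show "letter 1 < x" using c by (auto simp: letter_def elim!: evenE)
  qed (simp add: S_def)
  then have "codes S (decode cs) = map (\<lambda>x. 2 * x - 2) (rev (sort evs)) @ codes S (sort ods)"
    unfolding dec by (intro codes_decreasing_append) (auto simp: sorted_wrt_rev S_def dec)
  then have "mset (codes S (decode cs)) =
      mset (map (\<lambda>x. 2 * x - 2) evs) + mset (map (\<lambda>x. 2 * x - 1) ods)"
    by (simp add: codes_sorted)
  also have "map (\<lambda>x. 2 * x - 2) evs = filter even cs"
    by (auto simp: evs_def letter_def intro!: map_idI)
  also have "map (\<lambda>x. 2 * x - 1) ods = filter odd cs"
    by (auto simp: ods_def letter_def intro!: map_idI)
  finally show ?thesis by (simp flip: S_def multiset_partition)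
qed

lemma codes_image_parking_functions:
  "(\<lambda>w. sort (codes (set w) w)) ` parking_functions m n = ballots (2 * m) 1 n"
proof (intro equalityI subsetI)
  fix b assume "b \<in> (\<lambda>w. sort (codes (set w) w)) ` parking_functions m n"
  then show "b \<in> ballots (2 * m) 1 n"
    using parking_function_iff_ballot by (auto simp: parking_functions_def)
next
  fix b assume b: "b \<in> ballots (2 * m) 1 n"
  then have "0 \<notin> set b" by (auto simp: ballots_def in_set_conv_nth)
  \<comment> \<open>The bound at index 0 is 1, so positivity forces the first entry.\<close>
  moreover have "1 \<in> set b" if "b \<noteq> []"
  proof -
    have "0 < b ! 0" "b ! 0 \<le> 1" using that b by (auto simp: ballots_def)
    then have "b ! 0 = 1" by linarith
    then show ?thesis using that by (metis length_greater_0_conv nth_mem)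
  qed
  ultimately have "sort (codes (set (decode b)) (decode b)) = sort b"
    by (intro properties_for_sort) (auto simp: mset_codes_decode)
  also have "sort b = b" using b by (simp add: ballots_def sorted_sort_id)
  finally have codes: "sort (codes (set (decode b)) (decode b)) = b" .
  moreover have "set (decode b) = letter ` set b"
    using mset_decode[of b] by (metis mset_eq_setD mset_map set_map)
  then have "decode b \<in> words"
    by (auto simp: words_def letter_def)
  ultimately show "b \<in> (\<lambda>w. sort (codes (set w) w)) ` parking_functions m n"
    using b parking_function_iff_ballot by force
qed

section \<open>Counting classes by their invariants\<close>

lemma card_image_eq_if_same_fibres:
  assumes "\<And>x y. x \<in> A \<Longrightarrow> y \<in> A \<Longrightarrow> f x = f y \<longleftrightarrow> g x = g y"
  shows "card (f ` A) = card (g ` A)"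
proof (rule bij_betw_same_card)
  have "f (inv_into A f (f x)) = f x" "inv_into A f (f x) \<in> A" if "x \<in> A" for x
    using that by (auto intro: f_inv_into_f inv_into_into)
  then have *: "g (inv_into A f (f x)) = g x" if "x \<in> A" for x
    using assms that by metis
  show "bij_betw (g \<circ> inv_into A f) (f ` A) (g ` A)"
    unfolding bij_betw_def inj_on_def using assms by (auto simp: * image_image)
qed

lemma card_hyposylvester_classes:
  "card (parking_functions m n // hyposylvester) = card (ballots (2 * m) 1 n)"
proof -
  have "hyposylvester `` {u} = hyposylvester `` {v} \<longleftrightarrow>
      sort (codes (set u) u) = sort (codes (set v) v)"
    if "u \<in> parking_functions m n" "v \<in> parking_functions m n" for u v
  proof -
    have uv: "u \<in> words" "v \<in> words" using that by (auto simp: parking_functions_def)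
    then have "hyposylvester `` {u} = hyposylvester `` {v} \<longleftrightarrow> (u, v) \<in> hyposylvester"
      using eq_equiv_class_iff[OF equiv_hyposylvester] by blast
    then show ?thesis using uv equivclp_hypo_step_iff by (simp add: hyposylvester_def)
  qed
  then have "card ((\<lambda>w. hyposylvester `` {w}) ` parking_functions m n) =
      card ((\<lambda>w. sort (codes (set w) w)) ` parking_functions m n)"
    by (rule card_image_eq_if_same_fibres)
  moreover have "(\<lambda>w. hyposylvester `` {w}) ` parking_functions m n = parking_functions m n // hyposylvester"
    by (auto simp: quotient_def)
  ultimately show ?thesis by (simp add: codes_image_parking_functions)
qed

section \<open>A common recursion for forests and ballots\<close>

definition forests :: "nat \<Rightarrow> nat \<Rightarrow> nat \<Rightarrow> tree list set" where
  "forests k p n = {ts. length ts = p \<and> (\<forall>t\<in>set ts. kary k t) \<and> sum_list (map internal_nodes ts) = n}"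

lemma forests_0: "forests k 0 n = (if n = 0 then {[]} else {})"
  by (auto simp: forests_def)

text \<open>One step of a preorder traversal, with \<open>p\<close> counting the trees still to be
  visited: a leaf is dropped, while a node is replaced by its \<open>k\<close> subtrees.\<close>

lemma forests_Suc:
  "forests k (Suc p) n = Cons Leaf ` forests k p n \<union>
    (case n of 0 \<Rightarrow> {} | Suc n' \<Rightarrow> (\<lambda>ts. Node (take k ts) # drop k ts) ` forests k (p + k) n')"
  (is "?L = ?R")
proof (intro equalityI subsetI)
  fix ts assume "ts \<in> ?L"
  then obtain t us where ts: "ts = t # us" "length us = p" "\<forall>t\<in>set us. kary k t" "kary k t"
    "internal_nodes t + sum_list (map internal_nodes us) = n"
    by (auto simp: forests_def length_Suc_conv)
  show "ts \<in> ?R"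
  proof (cases t)
    case Leaf
    with ts show ?thesis by (auto simp: forests_def)
  next
    case (Node vs)
    with ts obtain n' where n: "n = Suc n'" by (cases n) auto
    then have "vs @ us \<in> forests k (p + k) n'"
      using ts Node by (auto simp: forests_def)
    moreover have "ts = Node (take k (vs @ us)) # drop k (vs @ us)"
      using ts Node by auto
    ultimately show ?thesis unfolding n nat.case by blast
  qed
next
  fix ts assume "ts \<in> ?R"
  then consider (leaf) us where "ts = Leaf # us" "us \<in> forests k p n"
    | (node) n' vs where "n = Suc n'" "ts = Node (take k vs) # drop k vs" "vs \<in> forests k (p + k) n'"
    by (auto split: nat.splits)
  then show "ts \<in> ?L"
  proof cases
    case leaf
    then show ?thesis by (auto simp: forests_def)
  next
    case node
    have "sum_list (map internal_nodes (take k vs)) + sum_list (map internal_nodes (drop k vs)) =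
        sum_list (map internal_nodes vs)"
      by (metis append_take_drop_id map_append sum_list_append)
    then show ?thesis
      using node by (auto simp: forests_def dest: in_set_takeD in_set_dropD)
  qed
qed

lemma ballots_0: "ballots M 0 n = (if n = 0 then {[]} else {})"
  by (auto simp: ballots_def)

text \<open>Without an entry 1, all entries can be lowered by 1, as when a leaf is dropped.
  Otherwise sortedness puts a 1 in front; deleting it shifts the indices, and
  \<open>Suc p + M * Suc i = p + Suc M + M * i\<close> gives the new bound, as for a node of arity
  \<open>Suc M\<close>.\<close>

lemma ballots_Suc:
  "ballots M (Suc p) n = map Suc ` ballots M p n \<union>
    (case n of 0 \<Rightarrow> {} | Suc n' \<Rightarrow> Cons 1 ` ballots M (p + Suc M) n')"
  (is "?L = ?R")
proof (intro equalityI subsetI)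
  fix b assume b: "b \<in> ?L"
  show "b \<in> ?R"
  proof (cases "1 \<in> set b")
    case True
    then obtain c b' where cb: "b = c # b'" by (cases b) auto
    then have "c = 1" using b True by (force simp: ballots_def)
    moreover obtain n' where n: "n = Suc n'" using b cb by (auto simp: ballots_def)
    moreover have "b' \<in> ballots M (p + Suc M) n'"
    proof -
      have "0 < b' ! i \<and> b' ! i \<le> p + Suc M + M * i" if "i < n'" for i
        using b that unfolding ballots_def cb n by (force dest: spec[of _ "Suc i"])
      then show ?thesis using b by (auto simp: ballots_def cb n)
    qed
    ultimately show ?thesis using cb by auto
  next
    case False
    have gt: "1 < b ! i" if "i < n" for i
    proof -
      have "0 < b ! i" "b ! i \<noteq> 1"
        using b that False by (auto simp: ballots_def) (metis nth_mem)
      then show ?thesis by linarith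
    qed
    define b' where "b' = map (\<lambda>x. x - 1) b"
    have "b = map Suc b'"
      using b gt unfolding b'_def by (intro nth_equalityI) (force simp: ballots_def)+
    moreover from this have "b' \<in> ballots M p n"
      using b gt by (force simp: ballots_def sorted_map)
    ultimately show ?thesis by blast
  qed
next
  fix b assume "b \<in> ?R"
  then consider (shift) b' where "b = map Suc b'" "b' \<in> ballots M p n"
    | (one) n' b' where "n = Suc n'" "b = 1 # b'" "b' \<in> ballots M (p + Suc M) n'"
    by (auto split: nat.splits)
  then show "b \<in> ?L"
  proof cases
    case shift
    then show ?thesis by (auto simp: ballots_def sorted_map)
  next
    case one
    then have "\<forall>x\<in>set b'. 1 \<le> x" by (force simp: ballots_def in_set_conv_nth)
    with one show ?thesis
      by (auto simp: ballots_def nth_Cons split: nat.splits)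
  qed
qed

text \<open>Both families obey the same recursion. The node case raises \<open>p\<close> but lowers
  \<open>n\<close>, so the induction on \<open>p\<close> is nested inside the one on
  \<open>n\<close>.\<close>

lemma card_forests:
  "finite (forests (Suc M) p n) \<and> finite (ballots M p n) \<and>
    card (forests (Suc M) p n) = card (ballots M p n)"
proof (induction n arbitrary: p)
  case 0
  show ?case
  proof (induction p)
    case (Suc p)
    then show ?case
      by (simp add: forests_Suc ballots_Suc card_image inj_on_subset[OF inj_mapI[OF inj_Suc]])
  qed (simp add: forests_0 ballots_0)
next
  case (Suc n)
  note IH = Suc.IH
  show ?case
  proof (induction p)
    case (Suc p)
    let ?graft = "\<lambda>ts. Node (take (Suc M) ts) # drop (Suc M) ts"
    have inj: "inj ?graft"
      by (rule injI) (metis append_take_drop_id list.inject tree.inject)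
    have F: "forests (Suc M) (Suc p) (Suc n) =
        Cons Leaf ` forests (Suc M) p (Suc n) \<union> ?graft ` forests (Suc M) (p + Suc M) n"
      by (subst forests_Suc) simp
    have B: "ballots M (Suc p) (Suc n) =
        map Suc ` ballots M p (Suc n) \<union> Cons 1 ` ballots M (p + Suc M) n"
      by (subst ballots_Suc) simp
    \<comment> \<open>Entries of ballots are positive, so a shifted ballot cannot begin with
      1.\<close>
    have disj: "map Suc ` ballots M p (Suc n) \<inter> Cons 1 ` ballots M (p + Suc M) n = {}"
      by (auto simp: ballots_def)
    have "card (forests (Suc M) (Suc p) (Suc n)) =
        card (forests (Suc M) p (Suc n)) + card (forests (Suc M) (p + Suc M) n)"
      unfolding F using Suc IH[of "p + Suc M"]
      by (subst card_Un_disjoint) (auto simp: card_image inj_on_subset[OF inj])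
    moreover have "card (ballots M (Suc p) (Suc n)) =
        card (ballots M p (Suc n)) + card (ballots M (p + Suc M) n)"
      unfolding B using Suc IH[of "p + Suc M"] disj
      by (subst card_Un_disjoint) (auto simp: card_image inj_on_subset[OF inj_mapI[OF inj_Suc]])
    moreover have "finite (forests (Suc M) (Suc p) (Suc n))" "finite (ballots M (Suc p) (Suc n))"
      unfolding F B using Suc IH[of "p + Suc M"] by auto
    ultimately show ?case using Suc IH[of "p + Suc M"] by simp
  qed (simp add: forests_0 ballots_0)
qed

lemma card_kary_trees: "card (kary_trees k n) = card (forests k 1 n)"
proof (rule bij_betw_same_card)
  show "bij_betw (\<lambda>t. [t]) (kary_trees k n) (forests k 1 n)"
    by (auto simp: bij_betw_def inj_on_def kary_trees_def forests_def length_Suc_conv)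
qed

theorem proposition6p1:
  fixes m n :: nat
  assumes "m \<ge> 1" and "n \<ge> 1"
  shows "card (parking_functions m n // hyposylvester) = card (kary_trees (2 * m + 1) n)"
  using card_forests[of "2 * m" 1 n]
  by (simp add: card_hyposylvester_classes card_kary_trees)

end
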